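(* A positional numeration system $U$ is Bertrand if and only if one of the following holds: (1) $\mathrm{rep}_U(U(i)-1)=\mathrm{Pref}_i(10^\omega)$ for all $i\ge0$; (2) there exists a real number $\beta>1$ such that $\mathrm{rep}_U(U(i)-1)=\mathrm{Pref}_i(d^*_\beta(1))$ for all $i\ge0$; (3) there exists a real number $\beta>1$ such that $\mathrm{rep}_U(U(i)-1)=\mathrm{Pref}_i(d_\beta(1))$ for all $i\ge0$.
   Context: A positional numeration system is an increasing sequence of integers $U=(U(i))_{i\ge 0}$ with $U(0)=1$ and $\sup_i U(i+1)/U(i)<\infty$. The greedy $U$-representation $\mathrm{rep}_U(n)$ of $n\in\mathbb{N}$ is the unique word $a_1\cdots a_\ell$ over $\mathbb{N}$ with $n=\sum_{i=1}^\ell a_iU(\ell-i)$, $a_1\neq 0$, and $\sum_{i=j}^\ell a_iU(\ell-i)<U(\ell-j+1)$ for all $j$. The alphabet is $A_U=\{0,\ldots,\sup_{i\ge0}\lceil U(i+1)/U(i)\rceil-1\}$ and $\mathcal{N}_U=0^*\mathrm{rep}_U(\mathbb{N})$. $U$ is Bertrand if for all $w\in A_U^*$, $w\in\mathcal{N}_U\iff w0\in\mathcal{N}_U$. $\mathrm{Pref}_i(w)$ is the length-$i$ prefix of the infinite word $w$. For real $\beta>1$ and $x\in[0,1]$, $d_\beta(x)=\varepsilon_1\varepsilon_2\cdots$ with $r_0=x$, $\varepsilon_i=\lfloor\beta r_{i-1}\rfloor$, $r_i=\beta r_{i-1}-\varepsilon_i$; $d^*_\beta(1)=\lim_{x\to1^-}d_\beta(x)$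 (limit in the prefix topology). *)

theory Defs
  imports "HOL-Analysis.Analysis" "HOL-Library.Omega_Words_Fun"
begin

section \<open>Positional numeration systems\<close>

definition positional_numeration_system :: "(nat \<Rightarrow> nat) \<Rightarrow> bool" where
  "positional_numeration_system U \<longleftrightarrow>
     strict_mono U \<and> U 0 = 1 \<and> bdd_above (range (\<lambda>i. real (U (i + 1)) / real (U i)))"

text \<open>
  Finite words are lists, most significant digit first and indexed from \<open>0\<close>: the digit \<open>a ! i\<close>
  of a word of length \<open>l\<close> has weight \<open>U (l - 1 - i)\<close>. The empty word represents \<open>0\<close>.
\<close>

definition is_greedy_rep :: "(nat \<Rightarrow> nat) \<Rightarrow> nat \<Rightarrow> nat list \<Rightarrow> bool" where
  "is_greedy_rep U n a \<longleftrightarrow>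
     n = (\<Sum>i<length a. a ! i * U (length a - 1 - i)) \<and>
     (a \<noteq> [] \<longrightarrow> a ! 0 \<noteq> 0) \<and>
     (\<forall>j<length a. (\<Sum>i=j..<length a. a ! i * U (length a - 1 - i)) < U (length a - j))"

lemma ex1_greedy_rep:
  assumes "positional_numeration_system U"
  shows "\<exists>!a. is_greedy_rep U n a"
proof -
  have sm: "strict_mono U" and U0: "U 0 = 1"
    using assms by (auto simp: positional_numeration_system_def)
  have pos: "U i > 0" for i
    using strict_mono_mono[OF sm, THEN monoD, of 0 i] U0 by simp
  define v where "v a j = (\<Sum>i=j..<length a. a ! i * U (length a - 1 - i))" for a :: "nat list" and j
  define G where "G a \<longleftrightarrow> (\<forall>j<length a. v a j < U (length a - j))" for a
  have rep_iff: "is_greedy_rep U n a \<longleftrightarrow> n = v a 0 \<and> (a \<noteq> [] \<longrightarrow> a ! 0 \<noteq> 0) \<and> G a" for n a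
    by (simp add: is_greedy_rep_def v_def G_def atLeast0LessThan)
  have v_Nil: "v [] j = 0" for j
    by (simp add: v_def)
  have v_Suc: "v (x # a) (Suc j) = v a j" for x a j
    unfolding v_def length_Cons sum.shift_bounds_Suc_ivl by simp
  have v_Cons: "v (x # a) 0 = x * U (length a) + v a 0" for x a
  proof -
    have "v (x # a) 0 = x * U (length a) + v (x # a) (Suc 0)"
      unfolding v_def by (subst sum.atLeast_Suc_lessThan) simp_all
    then show ?thesis by (simp only: v_Suc)
  qed
  have G_Cons: "G (x # a) \<longleftrightarrow> v (x # a) 0 < U (Suc (length a)) \<and> G a" for x a
    by (simp add: G_def All_less_Suc2 v_Suc)
  have bound: "v a 0 < U (length a)" if "G a" for a
    using that pos[of 0] by (cases "a = []") (auto simp: G_def v_Nil)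
  have unique: "a = b" if "length a = length b" "G a" "G b" "v a 0 = v b 0" for a b
    using that
  proof (induction a b rule: list_induct2)
    case (Cons x a y b)
    have "v a 0 < U (length a)" "v b 0 < U (length a)"
      using bound[of a] bound[of b] Cons.prems Cons.hyps by (simp_all add: G_Cons)
    moreover have eq: "x * U (length a) + v a 0 = y * U (length a) + v b 0"
      using Cons.prems Cons.hyps by (simp add: v_Cons)
    ultimately have "x = y"
      by (metis add.right_neutral div_less div_mult_self3 gr_implies_not_zero)
    then show ?case
      using Cons.IH Cons.prems eq by (simp add: G_Cons)
  qed simp
  have exist: "\<exists>a. length a = l \<and> G a \<and> v a 0 = m" if "m < U l" for m l
    using that
  proof (induction l arbitrary: m)
    case 0
    then show ?case by (simp add: U0 G_def v_Nil)
  next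
    case (Suc l)
    have "m mod U l < U l"
      using pos by simp
    then obtain a where a: "length a = l" "G a" "v a 0 = m mod U l"
      using Suc.IH by blast
    then have "length (m div U l # a) = Suc l \<and> G (m div U l # a) \<and> v (m div U l # a) 0 = m"
      using Suc.prems by (simp add: G_Cons v_Cons)
    then show ?case by blast
  qed
  have len: "length a \<le> length b"
    if "is_greedy_rep U n a" "is_greedy_rep U n b" for a b
  proof (cases a)
    case (Cons x c)
    have "U (length c) \<le> x * U (length c)"
      using that(1) Cons by (simp add: rep_iff)
    also have "\<dots> \<le> n"
      using that(1) Cons by (simp add: rep_iff v_Cons)
    also have "n < U (length b)"
      using that(2) bound[of b] by (simp add: rep_iff)
    finally show ?thesis
      using strict_mono_less[OF sm] Cons by simp
  qed simp
  define l where "l = (LEAST l. n < U l)"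
  have "n < U (Suc n)"
    using strict_mono_imp_increasing[OF sm, of "Suc n"] by simp
  then have l: "n < U l" "\<And>k. k < l \<Longrightarrow> U k \<le> n"
    unfolding l_def by (auto intro: LeastI dest: not_less_Least simp: not_less)
  then obtain a where a: "length a = l" "G a" "v a 0 = n"
    using exist by blast
  have "a ! 0 \<noteq> 0" if ne: "a \<noteq> []"
  proof -
    obtain x c where c: "a = x # c" using ne by (cases a) auto
    have "v c 0 < U (length c)"
      using bound[of c] a(2) c by (simp add: G_Cons)
    also have "\<dots> \<le> n"
      using l(2)[of "length c"] a(1) c by simp
    finally show ?thesis
      using a(3) c by (auto simp: v_Cons)
  qed
  then have "is_greedy_rep U n a"
    using a by (simp add: rep_iff)
  then show ?thesis
  proof (rule ex1I)
    fix b assume b: "is_greedy_rep U n b"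
    then show "b = a"
      using \<open>is_greedy_rep U n a\<close> len[of a b] len[of b a] unique[of b a] by (simp add: rep_iff)
  qed
qed

definition rep :: "(nat \<Rightarrow> nat) \<Rightarrow> nat \<Rightarrow> nat list" where
  "rep U n = (THE a. is_greedy_rep U n a)"

definition alphabet :: "(nat \<Rightarrow> nat) \<Rightarrow> nat set" where
  "alphabet U = {a. int a \<le> (SUP i. \<lceil>real (U (i + 1)) / real (U i)\<rceil>) - 1}"

definition numeration_language :: "(nat \<Rightarrow> nat) \<Rightarrow> nat list set" where
  "numeration_language U = {replicate k 0 @ rep U n | k n. True}"

definition bertrand :: "(nat \<Rightarrow> nat) \<Rightarrow> bool" where
  "bertrand U \<longleftrightarrow>
     (\<forall>w \<in> lists (alphabet U). w \<in> numeration_language U \<longleftrightarrow> w @ [0] \<in> numeration_language U)"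


section \<open>Expansions in a real base\<close>

fun beta_remainder :: "real \<Rightarrow> real \<Rightarrow> nat \<Rightarrow> real" where
  "beta_remainder \<beta> x 0 = x"
| "beta_remainder \<beta> x (Suc i) =
     \<beta> * beta_remainder \<beta> x i - of_int \<lfloor>\<beta> * beta_remainder \<beta> x i\<rfloor>"

text \<open>
  Infinite words are indexed from \<open>0\<close>, so the letter at position \<open>i\<close> is the digit
  $\varepsilon_{i+1}$. For \<open>\<beta> > 1\<close> and \<open>0 \<le> x \<le> 1\<close> all remainders are nonnegative, so that
  \<open>nat\<close> does not truncate.
\<close>

definition beta_expansion :: "real \<Rightarrow> real \<Rightarrow> nat word" where
  "beta_expansion \<beta> x = (\<lambda>i. nat \<lfloor>\<beta> * beta_remainder \<beta> x i\<rfloor>)"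

text \<open>
  The limit is taken in the product topology on \<^typ>\<open>nat \<Rightarrow> nat\<close> (with \<^typ>\<open>nat\<close> discrete);
  by \<open>tendsto_word_iff_prefix\<close> below, this is convergence of prefixes.
\<close>

definition quasi_greedy_expansion :: "real \<Rightarrow> nat word" where
  "quasi_greedy_expansion \<beta> = (THE w. (beta_expansion \<beta> \<longlongrightarrow> w) (at_left 1))"

lemma tendsto_word_iff:
  fixes f :: "'b \<Rightarrow> nat word"
  shows "(f \<longlongrightarrow> w) F \<longleftrightarrow> (\<forall>i. \<forall>\<^sub>F x in F. f x i = w i)"
proof -
  have "(f \<longlongrightarrow> w) F \<longleftrightarrow> (\<forall>i. ((\<lambda>x. f x i) \<longlongrightarrow> w i) F)"
    using limitin_componentwise[of "\<lambda>_. euclidean :: nat topology" UNIV f w F]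
    by (simp add: euclidean_product_topology)
  then show ?thesis
    by (simp add: tendsto_discrete)
qed

lemma tendsto_word_iff_prefix:
  fixes f :: "'b \<Rightarrow> nat word"
  shows "(f \<longlongrightarrow> w) F \<longleftrightarrow> (\<forall>n. \<forall>\<^sub>F x in F. prefix n (f x) = prefix n w)"
  unfolding tendsto_word_iff
proof safe
  fix n
  assume "\<forall>i. \<forall>\<^sub>F x in F. f x i = w i"
  then have "\<forall>\<^sub>F x in F. \<forall>i\<in>{..<n}. f x i = w i"
    by (intro eventually_ball_finite) auto
  then show "\<forall>\<^sub>F x in F. prefix n (f x) = prefix n w"
    by eventually_elim (simp add: subsequence_def)
next
  fix i
  assume "\<forall>n. \<forall>\<^sub>F x in F. prefix n (f x) = prefix n w"
  then have "\<forall>\<^sub>F x in F. prefix (Suc i) (f x) = prefix (Suc i) w" ..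
  then show "\<forall>\<^sub>F x in F. f x i = w i"
    by eventually_elim (simp add: subsequence_def)
qed

lemma quasi_greedy_expansion:
  assumes "\<beta> > 1"
  shows "(beta_expansion \<beta> \<longlongrightarrow> quasi_greedy_expansion \<beta>) (at_left 1)"
proof -
  define l :: "real \<Rightarrow> int" where "l y = \<lceil>\<beta> * y\<rceil> - 1" for y
  have digit: "\<forall>\<^sub>F x in at_left 1. \<lfloor>\<beta> * g x\<rfloor> = l y"
    if g: "filterlim g (at_left y) (at_left 1)" for g :: "real \<Rightarrow> real" and y
  proof -
    have "of_int (l y) / \<beta> < y"
      using assms by (simp add: l_def pos_divide_less_eq mult.commute) linarith
    then have "\<forall>\<^sub>F z in at_left y. z \<in> {of_int (l y) / \<beta><..<y}"
      by (rule eventually_at_left_real)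
    then have "\<forall>\<^sub>F z in at_left y. \<lfloor>\<beta> * z\<rfloor> = l y"
    proof (rule eventually_mono)
      fix z assume z: "z \<in> {of_int (l y) / \<beta><..<y}"
      then have "of_int (l y) < \<beta> * z" "\<beta> * z < \<beta> * y"
        using assms by (simp_all add: pos_divide_less_eq mult.commute)
      then show "\<lfloor>\<beta> * z\<rfloor> = l y"
        unfolding l_def by linarith
    qed
    then show ?thesis
      using g by (rule eventually_compose_filterlim)
  qed
  have rem: "\<exists>y. filterlim (\<lambda>x. beta_remainder \<beta> x i) (at_left y) (at_left 1)" for i
  proof (induction i)
    case 0
    have "filterlim (\<lambda>x. x) (at_left 1) (at_left (1::real))"
      by (rule filterlim_ident)
    then show ?case by auto
  next
    case (Suc i)
    then obtain y where y: "filterlim (\<lambda>x. beta_remainder \<beta> x i) (at_left y) (at_left 1)"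
      by blast
    have lim: "((\<lambda>x. beta_remainder \<beta> x i) \<longlongrightarrow> y) (at_left 1)"
      and less: "\<forall>\<^sub>F x in at_left 1. beta_remainder \<beta> x i < y"
      using y by (auto simp: filterlim_at elim: eventually_mono)
    have "filterlim (\<lambda>x. \<beta> * beta_remainder \<beta> x i - of_int (l y)) (at_left (\<beta> * y - of_int (l y))) (at_left 1)"
      unfolding filterlim_at using less assms
      by (auto intro!: tendsto_intros lim elim!: eventually_mono)
    moreover have "\<forall>\<^sub>F x in at_left 1.
        beta_remainder \<beta> x (Suc i) = \<beta> * beta_remainder \<beta> x i - of_int (l y)"
      using digit[OF y] by eventually_elim simp
    ultimately show ?case
      by (subst filterlim_cong[OF refl refl]) auto
  qed
  have "\<exists>d. \<forall>\<^sub>F x in at_left 1. beta_expansion \<beta> x i = d" for i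
  proof -
    obtain y where "filterlim (\<lambda>x. beta_remainder \<beta> x i) (at_left y) (at_left 1)"
      using rem by blast
    from digit[OF this] have "\<forall>\<^sub>F x in at_left 1. beta_expansion \<beta> x i = nat (l y)"
      by eventually_elim (simp add: beta_expansion_def)
    then show ?thesis ..
  qed
  then obtain w where w: "\<And>i. \<forall>\<^sub>F x in at_left 1. beta_expansion \<beta> x i = w i"
    by metis
  have "(beta_expansion \<beta> \<longlongrightarrow> w) (at_left 1)"
    unfolding tendsto_word_iff by (simp add: w)
  moreover have "v = w" if "(beta_expansion \<beta> \<longlongrightarrow> v) (at_left 1)" for v
  proof
    fix i
    have "\<forall>\<^sub>F x in at_left (1::real). v i = w i"
      using that[unfolded tendsto_word_iff, rule_format, of i] w[of i]
      by eventually_elim simp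
    then show "v i = w i" by simp
  qed
  ultimately show ?thesis
    unfolding quasi_greedy_expansion_def by (rule theI)
qed

end

theory Submission
  imports Defs
begin

text \<open>
  The greedy words of length \<open>i\<close> are ordered lexicographically as their values, so a word is greedy
  iff each of its suffixes is lexicographically at most the word \<open>rep U (U i - 1)\<close> of the same
  length \<open>i\<close>. Hence \<open>U\<close> is Bertrand iff these maximal words are the prefixes of one infinite word
  \<open>d\<close>, and then no shift of \<open>d\<close> exceeds \<open>d\<close>. By an argument of Parry, unless \<open>d\<close> is $10^\omega$,
  such a \<open>d\<close> is an expansion of \<open>1\<close> in some base \<open>\<beta> > 1\<close> all of whose remainders lie in $[0,1]$.
  If no remainder vanishes, \<open>d\<close> is the quasi-greedy expansion; otherwise no remainder but the
  initial one equals \<open>1\<close>, and \<open>d\<close> is the greedy expansion.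
\<close>

section \<open>Greedy words\<close>

fun word_value :: "(nat \<Rightarrow> nat) \<Rightarrow> nat list \<Rightarrow> nat" where
  "word_value U [] = 0"
| "word_value U (x # a) = x * U (length a) + word_value U a"

text \<open>Unlike in \<open>is_greedy_rep\<close>, leading zeros are allowed, so that the predicate
  can describe all of \<open>numeration_language U\<close>.\<close>

fun greedy :: "(nat \<Rightarrow> nat) \<Rightarrow> nat list \<Rightarrow> bool" where
  "greedy U [] \<longleftrightarrow> True"
| "greedy U (x # a) \<longleftrightarrow> word_value U (x # a) < U (Suc (length a)) \<and> greedy U a"

lemma word_value_conv_sum:
  "word_value U a = (\<Sum>i<length a. a ! i * U (length a - 1 - i))"
  by (induction a) (simp_all add: sum.lessThan_Suc_shift del: sum.lessThan_Suc)

lemma word_value_drop: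
  "word_value U (drop j a) = (\<Sum>i=j..<length a. a ! i * U (length a - 1 - i))"
proof (cases "j \<le> length a")
  case True
  have "word_value U (drop j a) = (\<Sum>i<length a - j. a ! (i + j) * U (length a - 1 - (i + j)))"
    using True by (auto simp: word_value_conv_sum add.commute intro!: sum.cong)
  also have "\<dots> = (\<Sum>i=j..<length a. a ! i * U (length a - 1 - i))"
    using sum.shift_bounds_nat_ivl[of "\<lambda>i. a ! i * U (length a - 1 - i)" 0 j "length a - j"] True
    by (simp add: atLeast0LessThan)
  finally show ?thesis .
qed simp

lemma greedy_iff_drop:
  "greedy U a \<longleftrightarrow> (\<forall>j<length a. word_value U (drop j a) < U (length a - j))"
  by (induction a) (simp_all add: All_less_Suc2)

lemma is_greedy_rep_iff:
  "is_greedy_rep U n a \<longleftrightarrow> n = word_value U a \<and> (a \<noteq> [] \<longrightarrow> hd a \<noteq> 0) \<and> greedy U a"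
  unfolding is_greedy_rep_def greedy_iff_drop
    word_value_drop[symmetric] word_value_conv_sum[symmetric]
  by (cases a) auto

lemma greedy_drop: "greedy U a \<Longrightarrow> greedy U (drop k a)"
  by (induction a arbitrary: k) (auto simp: drop_Cons split: nat.splits)

lemma word_value_last_digit_mono:
  "c \<le> c' \<Longrightarrow> word_value U (a @ [c]) \<le> word_value U (a @ [c'])"
  by (induction a) simp_all

text \<open>Lowering the last digit cannot raise the value of any suffix, so all bounds survive.
  Used to replace that digit by \<open>0\<close>.\<close>

lemma greedy_last_digit_mono: "c \<le> c' \<Longrightarrow> greedy U (a @ [c']) \<Longrightarrow> greedy U (a @ [c])"
proof (induction a)
  case Nil
  then show ?case
    using mult_le_mono1[of c c' "U 0"] by (simp only: word_value.simps greedy.simps append_Nil list.size) linarith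
next
  case (Cons x a)
  then show ?case
    using word_value_last_digit_mono[of c c' U "x # a"] by simp
qed

text \<open>\<open>0\<close> is the least digit, so even when \<open>a = b\<close> the last position
  cannot spoil the order.\<close>

lemma lexordp_eq_snoc_0:
  fixes c :: nat
  assumes "length a = length b"
  shows "lexordp_eq (a @ [0]) (b @ [c]) \<longleftrightarrow> lexordp_eq a b"
  using assms by (induction a b rule: list_induct2) auto

lemma lexordp_eq_snoc:
  fixes x y :: "'a::linorder"
  shows "lexordp_eq (a @ [x]) (a @ [y]) \<longleftrightarrow> x \<le> y"
  by (induction a) auto

text \<open>\<open>v\<close> and \<open>v'\<close> are remainders modulo \<open>u\<close>, so the
  quotients are compared first.\<close>

lemma digit_expansion_le_iff:
  assumes "v < u" "v' < (u::nat)"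
  shows "x * u + v \<le> y * u + v' \<longleftrightarrow> x < y \<or> x = y \<and> v \<le> v'"
proof -
  have less: "p * u + s < q * u + t" if "p < q" "s < u" for p q s t
  proof -
    have "p * u + s < Suc p * u" using that by simp
    also have "\<dots> \<le> q * u" using that by (intro mult_right_mono) auto
    finally show ?thesis by simp
  qed
  show ?thesis
    using less[of x y v v'] less[of y x v' v] assms by (cases x y rule: linorder_cases) auto
qed

section \<open>Greedy words of a fixed numeration system\<close>

locale numeration_system =
  fixes U :: "nat \<Rightarrow> nat"
  assumes numeration_system: "positional_numeration_system U"
begin

lemma strict_mono_U: "strict_mono U" and U_0: "U 0 = 1"
  using numeration_system by (auto simp: positional_numeration_system_def)

lemma U_pos: "U i > 0"
  using strict_mono_mono[OF strict_mono_U, THEN monoD, of 0 i] U_0 by simp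

lemma U_less_Suc: "U i < U (Suc i)"
  using strict_mono_U by (simp add: strict_mono_Suc_iff)

lemma is_greedy_rep_rep: "is_greedy_rep U n (rep U n)"
  unfolding rep_def by (rule theI'[OF ex1_greedy_rep[OF numeration_system]])

lemma rep_eqI: "is_greedy_rep U n a \<Longrightarrow> rep U n = a"
  using ex1_greedy_rep[OF numeration_system] is_greedy_rep_rep by blast

lemma greedy_value_less: "greedy U a \<Longrightarrow> word_value U a < U (length a)"
  by (cases a) (simp_all add: U_0)

lemma greedy_Cons_0: "greedy U (0 # a) \<longleftrightarrow> greedy U a"
  using greedy_value_less[of a] U_less_Suc[of "length a"] by auto

text \<open>Leading zeros do not affect greediness because \<open>U\<close> increases; once they are
  stripped, a greedy word is the representation of its value.\<close>

lemma numeration_language_iff_greedy: "w \<in> numeration_language U \<longleftrightarrow> greedy U w"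
proof
  assume "w \<in> numeration_language U"
  then obtain k n where "w = replicate k 0 @ rep U n"
    by (auto simp: numeration_language_def)
  moreover have "greedy U (replicate k 0 @ rep U n)"
    using is_greedy_rep_rep[of n]
    by (induction k) (simp_all add: is_greedy_rep_iff greedy_Cons_0 del: greedy.simps(2))
  ultimately show "greedy U w" by simp
next
  assume "greedy U w"
  then show "w \<in> numeration_language U"
  proof (induction w)
    case Nil
    then have "rep U 0 = []"
      by (intro rep_eqI) (simp add: is_greedy_rep_iff)
    then have "[] = replicate 0 0 @ rep U 0" by simp
    then show ?case unfolding numeration_language_def by blast
  next
    case (Cons x a)
    show ?case
    proof (cases "x = 0")
      case True
      with Cons obtain k n where "a = replicate k 0 @ rep U n"
        by (auto simp: numeration_language_def)
      then have "x # a = replicate (Suc k) 0 @ rep U n"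
        using True by simp
      then show ?thesis unfolding numeration_language_def by blast
    next
      case False
      then have "rep U (word_value U (x # a)) = x # a"
        using Cons.prems by (intro rep_eqI) (simp add: is_greedy_rep_iff)
      then have "x # a = replicate 0 0 @ rep U (word_value U (x # a))" by simp
      then show ?thesis unfolding numeration_language_def by blast
    qed
  qed
qed

text \<open>The greedy algorithm: the quotient by \<open>U l\<close> is the leading digit, and the
  remainder is treated in the same way.\<close>

lemma ex_greedy: "m < U l \<Longrightarrow> \<exists>a. length a = l \<and> greedy U a \<and> word_value U a = m"
proof (induction l arbitrary: m)
  case 0
  then show ?case by (simp add: U_0)
next
  case (Suc l)
  have "m mod U l < U l"
    using U_pos by simp
  then obtain a where "length a = l" "greedy U a" "word_value U a = m mod U l"
    using Suc.IH by blast
  then have "length (m div U l # a) = Suc l \<and> greedy U (m div U l # a) \<and>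
      word_value U (m div U l # a) = m"
    using Suc.prems by simp
  then show ?case by blast
qed

section \<open>Maximal words and the lexicographic order\<close>

definition max_word :: "nat \<Rightarrow> nat list" where
  "max_word i = rep U (U i - 1)"

lemma max_word:
  shows length_max_word: "length (max_word i) = i"
    and greedy_max_word: "greedy U (max_word i)"
    and value_max_word: "word_value U (max_word i) = U i - 1"
    and hd_max_word: "i > 0 \<Longrightarrow> hd (max_word i) \<noteq> 0"
proof -
  have "U i - 1 < U i"
    using U_pos[of i] by simp
  then obtain a where a: "length a = i" "greedy U a" "word_value U a = U i - 1"
    using ex_greedy by blast
  \<comment> \<open>With a leading \<open>0\<close> the value would be that of the tail, below
    \<open>U (i - 1)\<close>, which is at most \<open>U i - 1\<close>.\<close>
  have hd: "hd a \<noteq> 0" if ne: "a \<noteq> []"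
  proof -
    obtain x b where b: "a = x # b" using ne by (cases a) auto
    have "word_value U b < U (length b)"
      using a(2) b greedy_value_less by simp
    also have "\<dots> \<le> U i - 1"
      using U_less_Suc[of "length b"] a(1) b by auto
    finally show ?thesis
      using a(3) b by (cases "x = 0") auto
  qed
  have "max_word i = a"
    unfolding max_word_def by (rule rep_eqI) (simp add: is_greedy_rep_iff a hd)
  then show "length (max_word i) = i" "greedy U (max_word i)"
    "word_value U (max_word i) = U i - 1" "i > 0 \<Longrightarrow> hd (max_word i) \<noteq> 0"
    using a hd length_greater_0_conv[of a] by simp_all
qed

text \<open>The value of a greedy tail is below the weight of the digit before it, so the first
  differing digit decides.\<close>

lemma value_le_iff_lexordp_eq:
  assumes "length a = length b" "greedy U a" "greedy U b"
  shows "word_value U a \<le> word_value U b \<longleftrightarrow> lexordp_eq a b"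
  using assms
proof (induction a b rule: list_induct2)
  case (Cons x a y b)
  have "word_value U a < U (length a)" "word_value U b < U (length a)"
    using greedy_value_less[of a] greedy_value_less[of b] Cons.prems Cons.hyps by simp_all
  then show ?case
    using Cons by (auto simp: digit_expansion_le_iff)
qed simp

lemma greedy_Cons_iff:
  "greedy U (x # a) \<longleftrightarrow> greedy U a \<and> lexordp_eq (x # a) (max_word (Suc (length a)))"
proof (cases "greedy U a")
  case True
  obtain y b where b: "max_word (Suc (length a)) = y # b"
    using length_max_word[of "Suc (length a)"] by (cases "max_word (Suc (length a))") auto
  have len: "length a = length b"
    using length_max_word[of "Suc (length a)"] b by simp
  have g: "greedy U b"
    using greedy_max_word[of "Suc (length a)"] b by simp
  have "greedy U (x # a) \<longleftrightarrow> word_value U (x # a) < U (Suc (length a))"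
    using True by simp
  also have "\<dots> \<longleftrightarrow> word_value U (x # a) \<le> word_value U (max_word (Suc (length a)))"
    using U_pos[of "Suc (length a)"] unfolding value_max_word by linarith
  \<comment> \<open>\<open>x # a\<close> is not known to be greedy, so the leading digits are split
    off and the order lemma is applied to the greedy tails only.\<close>
  also have "\<dots> \<longleftrightarrow> x < y \<or> x = y \<and> word_value U a \<le> word_value U b"
    using greedy_value_less[OF True] greedy_value_less[OF g] len
    unfolding b by (simp add: digit_expansion_le_iff)
  also have "\<dots> \<longleftrightarrow> lexordp_eq (x # a) (y # b)"
    using value_le_iff_lexordp_eq[OF len True g] by auto
  finally show ?thesis
    using True b by simp
qed simp

lemma greedy_lexordp_eq_max_word: "greedy U a \<Longrightarrow> lexordp_eq a (max_word (length a))"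
  by (cases a) (auto simp: greedy_Cons_iff simp del: greedy.simps(2))

text \<open>The bound on the suffix starting at a digit makes this digit smaller than a ratio of
  consecutive terms of \<open>U\<close>. Hence the restriction to \<open>alphabet U\<close> in
  \<open>bertrand\<close> excludes no greedy word.\<close>

lemma greedy_in_alphabet: "greedy U a \<Longrightarrow> a \<in> lists (alphabet U)"
proof (induction a)
  case (Cons x a)
  define q where "q i = real (U (i + 1)) / real (U i)" for i
  obtain B where B: "q i \<le> B" for i
    using numeration_system
    unfolding positional_numeration_system_def bdd_above_def q_def by auto
  \<comment> \<open>For integers the supremum is known to be an upper bound only if the set is
    bounded above; the bounded ratios of \<open>U\<close> give this.\<close>
  have "bdd_above (range (\<lambda>i. \<lceil>q i\<rceil>))"
    by (rule bdd_aboveI[of _ "\<lceil>B\<rceil>"]) (auto intro: ceiling_mono B)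
  then have "\<lceil>q (length a)\<rceil> \<le> (SUP i. \<lceil>q i\<rceil>)"
    by (rule cSUP_upper[rotated]) simp
  moreover have "real x < q (length a)"
  proof -
    have "x * U (length a) < U (Suc (length a))"
      using Cons.prems by simp
    then have "real (x * U (length a)) < real (U (Suc (length a)))"
      by (simp only: of_nat_less_iff)
    then show ?thesis
      using U_pos by (simp add: q_def pos_less_divide_eq)
  qed
  ultimately have "int x \<le> (SUP i. \<lceil>q i\<rceil>) - 1"
    by linarith
  then show ?case
    using Cons by (simp add: alphabet_def q_def)
qed simp

section \<open>The Bertrand condition as a property of maximal words\<close>

lemma bertrand_iff_greedy: "bertrand U \<longleftrightarrow> (\<forall>w. greedy U w \<longleftrightarrow> greedy U (w @ [0]))"
proof -
  have "w \<in> lists (alphabet U)" if "greedy U (w @ [0])" for w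
    using greedy_in_alphabet[OF that] by simp
  then show ?thesis
    using greedy_in_alphabet unfolding bertrand_def numeration_language_iff_greedy by blast
qed

text \<open>Each suffix is tested against a maximal word. Appending \<open>0\<close> to the suffix
  extends that maximal word by one letter of \<open>d\<close>, which leaves the outcome
  unchanged.\<close>

lemma bertrand_if_prefixes:
  assumes d: "\<And>i. max_word i = prefix i d"
  shows "bertrand U"
  unfolding bertrand_iff_greedy
proof
  fix w
  show "greedy U w \<longleftrightarrow> greedy U (w @ [0])"
  proof (induction w)
    case Nil
    then show ?case using U_pos by simp
  next
    case (Cons x a)
    have "lexordp_eq ((x # a) @ [0]) (max_word (Suc (length a)) @ [d (Suc (length a))])
        \<longleftrightarrow> lexordp_eq (x # a) (max_word (Suc (length a)))"
      by (rule lexordp_eq_snoc_0) (simp add: length_max_word)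
    moreover have "max_word (Suc (Suc (length a))) = max_word (Suc (length a)) @ [d (Suc (length a))]"
      by (simp add: d subsequence_def)
    ultimately show ?case
      using Cons by (simp add: greedy_Cons_iff del: greedy.simps(2))
  qed
qed

text \<open>Two inequalities: the last letter of \<open>max_word (Suc i)\<close> can be lowered to
  \<open>0\<close> and then dropped, leaving a greedy word; conversely
  \<open>max_word i @ [0]\<close> is greedy, hence at most \<open>max_word (Suc i)\<close>.\<close>

lemma butlast_max_word:
  assumes "bertrand U"
  shows "butlast (max_word (Suc i)) = max_word i"
proof -
  obtain p c where p: "max_word (Suc i) = p @ [c]"
    using length_max_word[of "Suc i"] by (cases "max_word (Suc i)" rule: rev_cases) auto
  have len: "length p = i"
    using length_max_word[of "Suc i"] p by simp
  have "greedy U (p @ [0])"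
    using greedy_max_word[of "Suc i"] p greedy_last_digit_mono[of 0 c] by simp
  then have "lexordp_eq p (max_word i)"
    using assms greedy_lexordp_eq_max_word[of p] len by (simp add: bertrand_iff_greedy)
  moreover have "greedy U (max_word i @ [0])"
    using assms greedy_max_word[of i] by (simp add: bertrand_iff_greedy)
  then have "lexordp_eq (max_word i @ [0]) (p @ [c])"
    using greedy_lexordp_eq_max_word[of "max_word i @ [0]"] p by (simp add: length_max_word)
  then have "lexordp_eq (max_word i) p"
    using len by (subst (asm) lexordp_eq_snoc_0) (simp_all add: length_max_word)
  ultimately show ?thesis
    using p lexordp_eq_antisym by auto
qed

lemma bertrand_imp_prefixes:
  assumes "bertrand U"
  shows "\<exists>d. \<forall>i. max_word i = prefix i d"
proof -
  define d where "d i = last (max_word (Suc i))" for i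
  have "max_word i = prefix i d" for i
  proof (induction i)
    case 0
    then show ?case using length_max_word[of 0] by simp
  next
    case (Suc i)
    have "max_word (Suc i) = butlast (max_word (Suc i)) @ [d i]"
      unfolding d_def using length_max_word[of "Suc i"]
      by (intro append_butlast_last_id[symmetric]) auto
    then show ?case
      using Suc by (simp add: butlast_max_word[OF assms] subsequence_def)
  qed
  then show ?thesis by blast
qed

text \<open>The letters of \<open>d\<close> from \<open>k\<close> to \<open>k + m\<close> end a
  maximal word, so they form a greedy word, at most the prefix of \<open>d\<close> of the same
  length. As the others agree, the last letters decide.\<close>

lemma max_word_shift_le:
  assumes d: "\<And>i. max_word i = prefix i d" and eq: "\<And>i. i < m \<Longrightarrow> d (k + i) = d i"
  shows "d (k + m) \<le> d m"
proof -
  have "drop k (max_word (k + Suc m)) = map (\<lambda>i. d (k + i)) [0..<Suc m]"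
    unfolding d by (rule nth_equalityI) (simp_all del: upt_Suc add: subsequence_def)
  also have "\<dots> = prefix m d @ [d (k + m)]"
    using eq by (simp add: subsequence_def)
  finally have "greedy U (prefix m d @ [d (k + m)])"
    using greedy_drop[OF greedy_max_word] by metis
  from greedy_lexordp_eq_max_word[OF this]
  have "lexordp_eq (prefix m d @ [d (k + m)]) (prefix m d @ [d m])"
    by (simp add: d subsequence_def)
  then show ?thesis
    by (simp only: lexordp_eq_snoc)
qed

end

section \<open>Words that dominate their shifts\<close>

text \<open>With \<open>x = 1 / \<beta>\<close>, these are the candidates for the remainders of the expansion of \<open>1\<close>.\<close>

definition tail_value :: "(nat \<Rightarrow> nat) \<Rightarrow> real \<Rightarrow> nat \<Rightarrow> real" where
  "tail_value d x k = x * (\<Sum>i. real (d (k + i)) * x ^ i)"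

text \<open>Parry's lexicographic condition on the shifts of \<open>d\<close>, phrased through the
  first letter at which a shift can differ from \<open>d\<close>.\<close>

locale shift_dominant =
  fixes d :: "nat \<Rightarrow> nat"
  assumes shift_le: "\<And>k m. (\<And>i. i < m \<Longrightarrow> d (k + i) = d i) \<Longrightarrow> d (k + m) \<le> d m"
begin

lemma digit_le: "d k \<le> d 0"
  using shift_le[of 0 k] by simp

lemma summable_digits:
  assumes "0 \<le> x" "x < 1"
  shows "summable (\<lambda>i. real (d (k + i)) * x ^ i)"
proof (rule summable_comparison_test')
  show "summable (\<lambda>i. real (d 0) * x ^ i)"
    using assms by (intro summable_mult summable_geometric) simp
  show "norm (real (d (k + i)) * x ^ i) \<le> real (d 0) * x ^ i" for i
    using assms digit_le[of "k + i"] by (simp add: abs_mult mult_right_mono)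
qed

lemma tail_value_nonneg: "0 \<le> x \<Longrightarrow> x < 1 \<Longrightarrow> 0 \<le> tail_value d x k"
  unfolding tail_value_def by (intro mult_nonneg_nonneg suminf_nonneg summable_digits) auto

lemma tail_value_rec:
  assumes "0 \<le> x" "x < 1"
  shows "tail_value d x k = x * (real (d k) + tail_value d x (Suc k))"
proof -
  have "(\<Sum>i. real (d (k + i)) * x ^ i) = real (d k) + (\<Sum>i. real (d (k + Suc i)) * x ^ Suc i)"
    using suminf_split_head[OF summable_digits[OF assms, of k]] by simp
  also have "(\<Sum>i. real (d (k + Suc i)) * x ^ Suc i) = (\<Sum>i. x * (real (d (Suc k + i)) * x ^ i))"
    by (intro suminf_cong) simp
  also have "\<dots> = x * (\<Sum>i. real (d (Suc k + i)) * x ^ i)"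
    by (rule suminf_mult[OF summable_digits[OF assms]])
  finally show ?thesis
    unfolding tail_value_def by simp
qed

text \<open>Crude but uniform in \<open>k\<close>: the starting point of the iteration in
  \<open>tail_value_le_1\<close>.\<close>

lemma tail_value_bounded:
  assumes "0 \<le> x" "x < 1"
  shows "tail_value d x k \<le> x * (\<Sum>i. real (d 0) * x ^ i)"
  unfolding tail_value_def
proof (intro mult_left_mono suminf_le summable_digits assms)
  show "summable (\<lambda>i. real (d 0) * x ^ i)"
    using assms by (intro summable_mult summable_geometric) simp
  show "real (d (k + i)) * x ^ i \<le> real (d 0) * x ^ i" for i
    using assms digit_le by (intro mult_right_mono) auto
qed

lemma tail_value_diff:
  assumes "0 \<le> x" "x < 1" and "\<And>i. i < m \<Longrightarrow> d (k + i) = d i"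
  shows "tail_value d x k - tail_value d x 0 = x ^ m * (tail_value d x (k + m) - tail_value d x m)"
  using assms(3)
proof (induction m)
  case (Suc m)
  then have "tail_value d x k - tail_value d x 0
      = x ^ m * (tail_value d x (k + m) - tail_value d x m)"
    by simp
  also have "tail_value d x (k + m) - tail_value d x m
      = x * (tail_value d x (Suc (k + m)) - tail_value d x (Suc m))"
    using Suc.prems[of m] tail_value_rec[OF assms(1,2), of "k + m"]
      tail_value_rec[OF assms(1,2), of m]
    by (simp add: algebra_simps)
  finally show ?case by simp
qed simp

text \<open>The excess over \<open>1\<close> contracts. At the first difference, at
  \<open>m\<close>, the shifted word loses at least \<open>1\<close> in its digit, so the excess at
  \<open>k\<close> is at most \<open>x ^ Suc m\<close> times that at \<open>Suc (k + m)\<close>.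
  Iterating from the uniform bound \<open>B\<close> leaves no positive excess.\<close>

lemma tail_value_le_1:
  assumes x: "0 < x" "x < 1" and one: "tail_value d x 0 = 1"
  shows "tail_value d x k \<le> 1"
proof -
  define B where "B = x * (\<Sum>i. real (d 0) * x ^ i)"
  have B: "tail_value d x k \<le> B" for k
    unfolding B_def using x by (intro tail_value_bounded) auto
  have "0 \<le> B"
    using B[of 0] one by simp
  have bound: "tail_value d x k - 1 \<le> x ^ n * B" for k n
  proof (induction n arbitrary: k)
    case 0
    then show ?case using B[of k] by simp
  next
    case (Suc n)
    show ?case
    proof (cases "\<forall>i. d (k + i) = d i")
      case True
      then have "tail_value d x k = 1"
        using one by (simp add: tail_value_def)
      then show ?thesis using \<open>0 \<le> B\<close> x by simp
    next
      case False
      define m where "m = (LEAST i. d (k + i) \<noteq> d i)"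
      have ne: "d (k + m) \<noteq> d m"
        using False LeastI_ex[of "\<lambda>i. d (k + i) \<noteq> d i"] unfolding m_def by blast
      have eq: "d (k + i) = d i" if "i < m" for i
        using not_less_Least[of i "\<lambda>i. d (k + i) \<noteq> d i"] that unfolding m_def by blast
      have less: "d (k + m) < d m"
        using shift_le[of m k] eq ne by force
      have "tail_value d x k - 1 = x ^ m * (tail_value d x (k + m) - tail_value d x m)"
        using tail_value_diff[of x m k] eq x one by simp
      also have "\<dots> = x ^ Suc m * (real (d (k + m)) + tail_value d x (Suc (k + m))
          - real (d m) - tail_value d x (Suc m))"
        using x by (simp add: tail_value_rec[of x "k + m"] tail_value_rec[of x m] algebra_simps)
      also have "\<dots> \<le> x ^ Suc m * (x ^ n * B)"
        using Suc[of "Suc (k + m)"] less tail_value_nonneg[of x "Suc m"] x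
        by (intro mult_left_mono) auto
      also have "\<dots> \<le> x ^ Suc n * B"
        using x \<open>0 \<le> B\<close> power_decreasing[of 0 m x]
        by (auto simp: mult_le_cancel_right1 mult.assoc mult.left_commute intro!: mult_left_le_one_le)
      finally show ?thesis .
    qed
  qed
  have "(\<lambda>n. x ^ n * B) \<longlonglongrightarrow> 0 * B"
    using x by (intro tendsto_intros LIMSEQ_power_zero) simp
  then have "tail_value d x k - 1 \<le> 0"
    using bound by (intro LIMSEQ_le_const[of "\<lambda>n. x ^ n * B"]) auto
  then show ?thesis by simp
qed

text \<open>Intermediate value theorem: the value at \<open>0\<close> is \<open>0\<close>, and close
  to \<open>1\<close> a finite partial sum already exceeds \<open>1\<close>.\<close>

lemma ex_tail_value_1:
  assumes large: "(\<Sum>i<N. d i) > 1"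
  obtains x where "0 < x" "x < 1" "tail_value d x 0 = 1"
proof -
  have "((\<lambda>x. x * (\<Sum>i<N. real (d i) * x ^ i)) \<longlongrightarrow> 1 * (\<Sum>i<N. real (d i) * 1 ^ i)) (at_left 1)"
    by (intro tendsto_intros)
  moreover have "1 * (\<Sum>i<N. real (d i) * 1 ^ i) > 1"
    using large by (simp flip: of_nat_sum)
  ultimately have "\<forall>\<^sub>F x in at_left 1. x * (\<Sum>i<N. real (d i) * x ^ i) > 1"
    by (rule order_tendstoD)
  moreover have "\<forall>\<^sub>F x in at_left (1::real). x \<in> {0<..<1}"
    by (rule eventually_at_left_real) simp
  ultimately have "\<forall>\<^sub>F x in at_left 1. x \<in> {0<..<1} \<and> x * (\<Sum>i<N. real (d i) * x ^ i) > 1"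
    by eventually_elim simp
  then obtain y where y: "0 < y" "y < 1" "y * (\<Sum>i<N. real (d i) * y ^ i) > 1"
    using eventually_happens' trivial_limit_at_left_real
    by (metis (no_types, lifting) greaterThanLessThan_iff)
  have "y * (\<Sum>i<N. real (d i) * y ^ i) \<le> tail_value d y 0"
    unfolding tail_value_def using summable_digits[of y 0] y
    by (intro mult_left_mono) (auto intro!: sum_le_suminf)
  then have ge: "1 \<le> tail_value d y 0"
    using y by simp
  \<comment> \<open>A point of convergence beyond \<open>y\<close> makes the power series continuous
    on all of \<open>[0, y]\<close>.\<close>
  define K where "K = (y + 1) / 2"
  have K: "y < K" "K < 1"
    using y by (auto simp: K_def)
  have "isCont (\<lambda>x. tail_value d x 0) x" if "0 \<le> x \<and> x \<le> y" for x
    unfolding tail_value_def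
    using summable_digits[of K 0] that K y by (intro continuous_intros isCont_powser[of _ K]) auto
  then have "\<exists>x\<ge>0. x \<le> y \<and> tail_value d x 0 = 1"
    using y ge by (intro IVT) (auto simp: tail_value_def)
  then obtain x where x: "0 \<le> x" "x \<le> y" "tail_value d x 0 = 1"
    by blast
  moreover from x have "x \<noteq> 0"
    by (auto simp: tail_value_def)
  ultimately show ?thesis
    using y by (intro that[of x]) auto
qed

section \<open>Recognising the greedy and quasi-greedy expansions\<close>

lemma beta_expansion_eqI:
  assumes x: "0 < x" "x < 1" and one: "tail_value d x 0 = 1"
    and less: "\<And>k. tail_value d x (Suc k) < 1"
  shows "beta_expansion (1 / x) 1 = d"
proof
  fix k
  \<comment> \<open>Multiplying a tail value by \<open>1 / x\<close> gives \<open>d k\<close> plus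
    the next tail value, which lies in \<open>[0, 1)\<close>.\<close>
  have floor: "\<lfloor>1 / x * tail_value d x k\<rfloor> = int (d k)" for k
    using x less[of k] tail_value_nonneg[of x "Suc k"]
    by (intro floor_unique) (auto simp: tail_value_rec[of x k])
  have rem: "beta_remainder (1 / x) 1 k = tail_value d x k" for k
  proof (induction k)
    case (Suc k)
    have "beta_remainder (1 / x) 1 (Suc k) = 1 / x * tail_value d x k - real (d k)"
      using Suc floor[of k] by simp
    also have "\<dots> = tail_value d x (Suc k)"
      using x by (simp add: tail_value_rec[of x k])
    finally show ?case .
  qed (simp add: one)
  show "beta_expansion (1 / x) 1 k = d k"
    unfolding beta_expansion_def rem floor by simp
qed

text \<open>Started at \<open>y < 1\<close> close enough to \<open>1\<close>, the
  \<open>k\<close>-th remainder is the tail value minus \<open>\<beta> ^ k * (1 - y)\<close>. This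
  correction is positive, which brings a tail value \<open>1\<close> below \<open>1\<close>, yet too
  small to make a positive tail value negative; so the digit is \<open>d k\<close>.\<close>

lemma quasi_greedy_expansion_eqI:
  assumes x: "0 < x" "x < 1" and one: "tail_value d x 0 = 1"
    and pos: "\<And>k. tail_value d x k > 0"
  shows "quasi_greedy_expansion (1 / x) = d"
proof -
  define \<beta> where "\<beta> = 1 / x"
  have \<beta>: "\<beta> > 1"
    using x by (simp add: \<beta>_def)
  have rec: "\<beta> * tail_value d x k = d k + tail_value d x (Suc k)" for k
    using x by (simp add: tail_value_rec[of x k] \<beta>_def)
  have floor: "\<forall>\<^sub>F y in at_left 1. \<lfloor>\<beta> * (tail_value d x k - \<beta> ^ k * (1 - y))\<rfloor> = int (d k)" for k
  proof -
    have "((\<lambda>y. \<beta> ^ Suc k * (1 - y)) \<longlongrightarrow> \<beta> ^ Suc k * (1 - 1)) (at_left 1)"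
      by (intro tendsto_intros)
    then have "\<forall>\<^sub>F y in at_left 1. \<beta> ^ Suc k * (1 - y) < tail_value d x (Suc k)"
      using pos[of "Suc k"] by (intro order_tendstoD) auto
    moreover have "\<forall>\<^sub>F y in at_left (1::real). y \<in> {0<..<1}"
      by (rule eventually_at_left_real) simp
    ultimately show ?thesis
    proof eventually_elim
      case (elim y)
      have "\<beta> * (tail_value d x k - \<beta> ^ k * (1 - y))
          = d k + (tail_value d x (Suc k) - \<beta> ^ Suc k * (1 - y))"
        using rec[of k] by (simp add: algebra_simps)
      moreover have "0 < \<beta> ^ Suc k * (1 - y)"
        using elim \<beta> by simp
      ultimately show ?case
        using elim(1) tail_value_le_1[OF x one, of "Suc k"] by (intro floor_unique) auto
    qed
  qed
  have rem: "\<forall>\<^sub>F y in at_left 1. beta_remainder \<beta> y k = tail_value d x k - \<beta> ^ k * (1 - y)" for k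
  proof (induction k)
    case (Suc k)
    with floor[of k] show ?case
    proof eventually_elim
      case (elim y)
      then have "beta_remainder \<beta> y (Suc k)
          = \<beta> * (tail_value d x k - \<beta> ^ k * (1 - y)) - real (d k)"
        by simp
      also have "\<dots> = tail_value d x (Suc k) - \<beta> ^ Suc k * (1 - y)"
        using rec[of k] by (simp add: algebra_simps)
      finally show ?case .
    qed
  qed (simp add: one)
  show ?thesis
  proof
    fix k
    have "\<forall>\<^sub>F y in at_left 1. beta_expansion \<beta> y k = d k"
      using floor[of k] rem[of k] by eventually_elim (simp add: beta_expansion_def)
    moreover have "\<forall>\<^sub>F y in at_left 1. beta_expansion \<beta> y k = quasi_greedy_expansion \<beta> k"
      using quasi_greedy_expansion[OF \<beta>] by (simp add: tendsto_word_iff)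
    ultimately have "\<forall>\<^sub>F y in at_left (1::real). quasi_greedy_expansion \<beta> k = d k"
      by eventually_elim simp
    then show "quasi_greedy_expansion (1 / x) k = d k"
      by (simp add: \<beta>_def)
  qed
qed

text \<open>Supplies the strict bound of \<open>beta_expansion_eqI\<close> when some remainder
  vanishes; by \<open>tail_value_le_1\<close> only a return to the value \<open>1\<close> has to be
  excluded.\<close>

lemma tail_value_Suc_less_1:
  assumes x: "0 < x" "x < 1" and one: "tail_value d x 0 = 1"
    and zero: "tail_value d x n = 0"
  shows "tail_value d x (Suc k) < 1"
proof (rule ccontr)
  define r where "r = tail_value d x"
  have nonneg: "0 \<le> r j" for j
    using x by (simp add: r_def tail_value_nonneg)
  have rec: "r j = x * (d j + r (Suc j))" for j
    using x unfolding r_def by (intro tail_value_rec) auto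
  have zeros: "r (n + j) = 0" if "r n = 0" for n j
  proof (induction j)
    case (Suc j)
    then have "real (d (n + j)) + r (Suc (n + j)) = 0"
      using rec[of "n + j"] x by simp
    then show ?case
      using nonneg[of "Suc (n + j)"] by simp
  qed (simp add: that)
  assume "\<not> ?thesis"
  then have r_k: "r (Suc k) = 1"
    using tail_value_le_1[OF x one, of "Suc k"] by (simp add: r_def)
  \<comment> \<open>A first digit below that of \<open>d\<close> would force \<open>r (m + 1) = 0\<close> and \<open>r (k + 1 + m + 1) = 1\<close>,
    which is impossible since remainders stay \<open>0\<close>. So \<open>d\<close> is periodic, and never vanishes.\<close>
  have same: "(\<forall>i<m. d (Suc k + i) = d i) \<and> r (Suc k + m) = r m" for m
  proof (induction m)
    case 0
    then show ?case using r_k one by (simp add: r_def)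
  next
    case (Suc m)
    have eq: "d (Suc k + m) + r (Suc (Suc k + m)) = d m + r (Suc m)"
      using Suc rec[of "Suc k + m"] rec[of m] x by simp
    have "d (Suc k + m) \<le> d m"
      using Suc by (intro shift_le) simp
    moreover have "\<not> d (Suc k + m) < d m"
    proof
      assume "d (Suc k + m) < d m"
      then have "r (Suc (Suc k + m)) \<ge> 1 + r (Suc m)"
        using eq by linarith
      then have *: "r (Suc (Suc k + m)) = 1" "r (Suc m) = 0"
        using tail_value_le_1[OF x one, of "Suc (Suc k + m)"] nonneg[of "Suc m"]
        by (simp_all add: r_def)
      then show False
        using zeros[of "Suc m" "Suc k"] by (simp add: add_ac)
    qed
    ultimately have "d (Suc k + m) = d m" by simp
    then show ?case
      using Suc eq by (auto simp: less_Suc_eq)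
  qed
  have "r (j * Suc k) = 1" for j
  proof (induction j)
    case (Suc j)
    then show ?case using same[of "j * Suc k"] by (simp add: add_ac)
  qed (use one in \<open>simp add: r_def\<close>)
  \<comment> \<open>The index \<open>n * Suc k = n + n * k\<close> is at least \<open>n\<close>,
    where the tail values are already \<open>0\<close>.\<close>
  from this[of n] zeros[OF zero[folded r_def], of "n * k"] show False
    by simp
qed

theorem eq_expansion_of_1:
  assumes "d 0 > 0" and ne: "d \<noteq> [1] \<frown> [0]\<^sup>\<omega>"
  shows "\<exists>\<beta>>1. d = quasi_greedy_expansion \<beta> \<or> d = beta_expansion \<beta> 1"
proof -
  \<comment> \<open>The digit sum reaches \<open>2\<close>: either \<open>d 0\<close> is at least
    \<open>2\<close>, or a leading \<open>1\<close> is followed by another nonzero digit.\<close>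
  obtain N where "(\<Sum>i<N. d i) > 1"
  proof (cases "d 0 = 1")
    case True
    have "\<exists>j>0. d j > 0"
    proof (rule ccontr)
      assume "\<not> ?thesis"
      then have "d i = 0" if "i > 0" for i
        using that by (metis gr0I)
      then have "d i = ([1] \<frown> [0]\<^sup>\<omega>) i" for i
        using True by (cases "i = 0") (simp_all add: conc_def iter_def)
      then have "d = [1] \<frown> [0]\<^sup>\<omega>" ..
      with ne show False ..
    qed
    then obtain j where j: "j > 0" "d j > 0" by blast
    have "(\<Sum>i\<in>{0, j}. d i) \<le> (\<Sum>i<Suc j. d i)"
      by (intro sum_mono2) auto
    then show ?thesis
      using True j by (intro that[of "Suc j"]) auto
  next
    case False
    then show ?thesis
      using assms(1) by (intro that[of 1]) auto
  qed
  then obtain x where x: "0 < x" "x < 1" "tail_value d x 0 = 1"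
    by (rule ex_tail_value_1)
  have "d = quasi_greedy_expansion (1 / x) \<or> d = beta_expansion (1 / x) 1"
  proof (cases "\<exists>n. tail_value d x n = 0")
    case True
    then show ?thesis
      using beta_expansion_eqI[OF x] tail_value_Suc_less_1[OF x] by metis
  next
    case False
    then have "tail_value d x n > 0" for n
      using tail_value_nonneg[of x n] x by (simp add: less_le)
    then show ?thesis
      using quasi_greedy_expansion_eqI[OF x] by simp
  qed
  moreover have "1 / x > 1"
    using x by simp
  ultimately show ?thesis by blast
qed

end

theorem theorem3:
  fixes U :: "nat \<Rightarrow> nat"
  assumes "positional_numeration_system U"
  shows "bertrand U \<longleftrightarrow>
      (\<forall>i. rep U (U i - 1) = prefix i ([1] \<frown> [0]\<^sup>\<omega>)) \<or>
      (\<exists>\<beta>>1. \<forall>i. rep U (U i - 1) = prefix i (quasi_greedy_expansion \<beta>)) \<or>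
      (\<exists>\<beta>>1. \<forall>i. rep U (U i - 1) = prefix i (beta_expansion \<beta> 1))"
    (is "_ \<longleftrightarrow> ?R")
proof
  interpret numeration_system U
    by unfold_locales (rule assms)
  assume "bertrand U"
  then obtain d where d: "\<And>i. max_word i = prefix i d"
    using bertrand_imp_prefixes by blast
  interpret shift_dominant d
    by unfold_locales (rule max_word_shift_le[OF d])
  have "d 0 > 0"
    using hd_max_word[of 1] by (simp add: d subsequence_def)
  then have "d = [1] \<frown> [0]\<^sup>\<omega> \<or> (\<exists>\<beta>>1. d = quasi_greedy_expansion \<beta> \<or> d = beta_expansion \<beta> 1)"
    using eq_expansion_of_1 by blast
  then show ?R
    using d unfolding max_word_def by metis
next
  interpret numeration_system U
    by unfold_locales (rule assms)
  assume ?R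
  \<comment> \<open>Each alternative presents the maximal words as prefixes of one infinite word,
    which is enough.\<close>
  then have "\<exists>d. \<forall>i. max_word i = prefix i d"
    unfolding max_word_def by blast
  then show "bertrand U"
    using bertrand_if_prefixes by blast
qed

end
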